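(* For every $M\in\mathbb N$, the probability that $\frac{a}{M}$, with $a\in\mathbb Z$ and $\gcd(a,M)=1$, has finite order equals $1$; that is, $$\sum_{n=0}^{\infty}\frac{A(n,M)}{\varphi(M^{n+1})}=1.$$
   Context: Let $\chi:\mathbb Q\to\mathbb Q$ be defined by $\chi(x)=x\lceil x\rceil$, where $\lceil x\rceil$ is the smallest integer greater than or equal to $x$. For $x\in\mathbb Q$, $\mathrm{ord}(x)=\min\{k\in\mathbb N_0:\chi^k(x)\in\mathbb Z\}$ if this set is nonempty, and $\mathrm{ord}(x)=\infty$ otherwise ($\mathbb N=\{1,2,\dots\}$, $\mathbb N_0=\mathbb N\cup\{0\}$). For $n\in\mathbb N_0$ and $M\in\mathbb N$, let $\mathcal A_{n,M}=\{a\in\mathbb Z:\gcd(a,M)=1,\ \mathrm{ord}(a/M)=n\}$; this set is a union of congruence classes modulo $M^{n+1}$, and $A(n,M)$ denotes the number of congruence classes modulo $M^{n+1}$ contained in $\mathcal A_{n,M}$. Thus $A(n,M)/\varphi(M^{n+1})$ is the proportion of residue classes modulo $M^{n+1}$ coprime to $M$ whose elements $a$ satisfy $\mathrm{ord}(a/M)=n$, interpreted as the probability that $a/M$ (with $\gcd(a,M)=1$) has order $n$. $\varphi$ is Euler's totient function. *)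

theory Defs
  imports Complex_Main "HOL-Library.Extended_Nat" "HOL-Number_Theory.Number_Theory"
begin

definition chi :: "rat \<Rightarrow> rat" where
  "chi x = x * of_int \<lceil>x\<rceil>"

definition chi_ord :: "rat \<Rightarrow> enat" where
  "chi_ord x = (if \<exists>k. (chi ^^ k) x \<in> \<int> then enat (LEAST k. (chi ^^ k) x \<in> \<int>) else \<infinity>)"

definition ord_set :: "nat \<Rightarrow> nat \<Rightarrow> int set" where
  "ord_set n M = {a. coprime a (int M) \<and> chi_ord (of_int a / of_nat M) = enat n}"

definition cong_class :: "nat \<Rightarrow> int \<Rightarrow> int set" where
  "cong_class m r = {b. [b = r] (mod int m)}"

definition class_count :: "nat \<Rightarrow> nat \<Rightarrow> nat" where
  "class_count n M = card {C \<in> range (cong_class (M ^ (n + 1))). C \<subseteq> ord_set n M}"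

end

theory Submission
  imports Defs
begin

text \<open>Write \<open>a = c M - s\<close> with \<open>c = \<lceil>a/M\<rceil>\<close> and \<open>0 \<le> s < M\<close>, and let \<open>c = g e\<close>, \<open>M = g d\<close> with
  \<open>g = gcd(c, M)\<close>. Then \<open>\<chi>(a/M) = e (g e M - s) / d\<close>. For fixed \<open>s\<close> and \<open>d\<close> the map
  \<open>e \<mapsto> e (g e M - s)\<close> permutes the units modulo every power of \<open>d\<close>, so the new numerator is again
  uniformly distributed. The denominators thus form a Markov chain on the divisors of \<open>M\<close> that moves
  from \<open>M\<close> to \<open>d\<close> with probability \<open>\<phi>(d)/M\<close>. Since \<open>\<phi>(M)/M < 1\<close> for \<open>M > 1\<close>, it is absorbed at
  \<open>1\<close> almost surely.\<close>

section \<open>Counting in periodic sets\<close>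

definition periodic :: "nat \<Rightarrow> int set \<Rightarrow> bool" where
  "periodic m S \<longleftrightarrow> (\<forall>a b. [a = b] (mod int m) \<longrightarrow> a \<in> S \<longrightarrow> b \<in> S)"

lemma periodicD: "periodic m S \<Longrightarrow> [a = b] (mod int m) \<Longrightarrow> a \<in> S \<longleftrightarrow> b \<in> S"
  unfolding periodic_def using cong_sym by blast

text \<open>Residues are represented in \<open>{1..m}\<close> rather than \<open>{0..<m}\<close> to
  suit the ceiling: if \<open>a = c * M - s\<close> with \<open>0 \<le> s < M\<close>, then
  \<open>a\<close> lies in \<open>{1..N * M}\<close> exactly when \<open>c\<close> lies in
  \<open>{1..N}\<close>.\<close>

lemma cong_imp_eq_atLeastAtMost:
  fixes a b :: int
  assumes "a \<in> {1..int m}" "b \<in> {1..int m}" "[a = b] (mod int m)"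
  shows "a = b"
proof -
  have "[a - 1 = b - 1] (mod int m)"
    using assms(3) by (simp add: cong_diff)
  then have "a - 1 = b - 1"
    using assms by (intro cong_less_imp_eq_int[of _ "int m"]) auto
  then show ?thesis by simp
qed

lemma cong_representative_ex:
  fixes x :: int
  assumes "m > 0"
  shows "\<exists>y\<in>{1..int m}. [x = y] (mod int m)"
proof
  have "(x - 1) mod int m < int m" "0 \<le> (x - 1) mod int m"
    using assms by (auto intro: pos_mod_bound)
  then show "(x - 1) mod int m + 1 \<in> {1..int m}" by auto
  have "[x - 1 = (x - 1) mod int m] (mod int m)"
    by (simp add: cong_def)
  then have "[x - 1 + 1 = (x - 1) mod int m + 1] (mod int m)"
    by (intro cong_add) auto
  then show "[x = (x - 1) mod int m + 1] (mod int m)" by simp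
qed

text \<open>The interval splits into \<open>t\<close> translates of one period; the induction
  detaches the last block. This later transfers a count over one period of a divisor
  \<open>d\<close> to a range dictated by \<open>M\<close>.\<close>

lemma card_periodic_mult:
  assumes "periodic m S"
  shows "card (S \<inter> {1..int (m * t)}) = t * card (S \<inter> {1..int m})"
proof (induction t)
  case (Suc t)
  have split: "S \<inter> {1..int (m * Suc t)} =
      (S \<inter> {1..int (m * t)}) \<union> (\<lambda>x. x + int (m * t)) ` (S \<inter> {1..int m})" (is "?L = ?A \<union> ?B")
  proof (intro equalityI subsetI)
    fix x assume x: "x \<in> ?L"
    show "x \<in> ?A \<union> ?B"
    proof (cases "x \<le> int (m * t)")
      case False
      have "[x = x - int (m * t)] (mod int m)"
        by (simp add: cong_iff_dvd_diff)
      then have "x - int (m * t) \<in> S \<inter> {1..int m}"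
        using periodicD[OF assms] x False by (auto simp: algebra_simps)
      then have "x \<in> ?B" by (intro image_eqI[where x = "x - int (m * t)"]) auto
      then show ?thesis by simp
    qed (use x in auto)
  next
    fix x assume "x \<in> ?A \<union> ?B"
    then show "x \<in> ?L"
    proof
      assume "x \<in> ?B"
      then obtain y where y: "y \<in> S" "1 \<le> y" "y \<le> int m" "x = y + int (m * t)" by auto
      have "[y = y + int (m * t)] (mod int m)"
        by (simp add: cong_iff_dvd_diff)
      then show ?thesis using y periodicD[OF assms] by (auto simp: algebra_simps intro: add_increasing2)
    next
      assume "x \<in> ?A"
      then have "x \<in> S" "1 \<le> x" "x \<le> int (m * t)" by auto
      moreover have "int (m * t) \<le> int (m * Suc t)" by simp
      ultimately show ?thesis by (simp del: of_nat_mult)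
    qed
  qed
  have "card (S \<inter> {1..int (m * Suc t)}) = card ?A + card ?B"
    unfolding split by (rule card_Un_disjoint) auto
  also have "card ?B = card (S \<inter> {1..int m})"
    by (intro card_image inj_onI) auto
  finally show ?case using Suc.IH by simp
qed auto

text \<open>A class lies in a periodic set as soon as one of its members does, and it meets
  \<open>{1..m}\<close> in exactly one point. Counting classes thus becomes counting
  integers.\<close>

lemma card_cong_classes_subset:
  assumes "periodic m S" "m > 0"
  shows "card {C \<in> range (cong_class m). C \<subseteq> S} = card (S \<inter> {1..int m})"
proof -
  have eq: "cong_class m x = cong_class m y \<longleftrightarrow> [x = y] (mod int m)" for x y
    unfolding cong_class_def by (auto simp: cong_def)
  have sub: "cong_class m x \<subseteq> S \<longleftrightarrow> x \<in> S" for x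
    using periodicD[OF assms(1)] unfolding cong_class_def by (auto simp: cong_sym_eq)
  have "{C \<in> range (cong_class m). C \<subseteq> S} = cong_class m ` (S \<inter> {1..int m})"
  proof (intro equalityI subsetI)
    fix C assume "C \<in> {C \<in> range (cong_class m). C \<subseteq> S}"
    then obtain x where x: "C = cong_class m x" "x \<in> S" using sub by auto
    obtain y where y: "y \<in> {1..int m}" "[x = y] (mod int m)"
      using cong_representative_ex[OF assms(2)] by blast
    then show "C \<in> cong_class m ` (S \<inter> {1..int m})"
      using x eq periodicD[OF assms(1)] by auto
  qed (use sub in auto)
  moreover have "inj_on (cong_class m) (S \<inter> {1..int m})"
    using eq cong_imp_eq_atLeastAtMost by (auto intro!: inj_onI)
  ultimately show ?thesis by (simp add: card_image)
qed

text \<open>The difference of two values of \<open>e \<mapsto> e (k e - s)\<close> is \<open>(e - e') ((e + e') k - s)\<close>, whose second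
  factor is a unit modulo \<open>d\<close>; hence the map is a permutation of the units modulo \<open>d ^ j\<close>.\<close>

lemma card_quadratic_preimage:
  fixes k s :: int
  assumes per: "periodic (d ^ j) S" and d: "d > 0" and k: "int d dvd k" and s: "coprime s (int d)"
    and S: "\<And>x. x \<in> S \<Longrightarrow> coprime x (int d)"
  shows "card {e \<in> {1..int (d ^ j)}. coprime e (int d) \<and> e * (k * e - s) \<in> S}
       = card (S \<inter> {1..int (d ^ j)})"
proof -
  define m where "m = d ^ j"
  define U where "U = {e \<in> {1..int m}. coprime e (int d)}"
  have m: "m > 0" using d by (simp add: m_def)
  obtain r where r: "\<And>x. r x \<in> {1..int m}" "\<And>x. [x = r x] (mod int m)"
    using cong_representative_ex[OF m] by metis
  define h where "h e = r (e * (k * e - s))" for e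
  have unit: "coprime (k * x - s) (int d)" for x
  proof -
    have "[k * x - s = 0 * x - s] (mod int d)"
      using k by (intro cong_diff cong_mult cong_refl) (simp add: cong_0_iff)
    then have "gcd (k * x - s) (int d) = gcd (- s) (int d)" by (simp add: cong_gcd_eq)
    then show ?thesis using s by (simp add: coprime_iff_gcd_eq_1)
  qed
  \<comment> \<open>Reduction modulo \<open>m\<close> respects coprimality to \<open>d\<close>
    because \<open>d\<close> divides \<open>m\<close>, which needs \<open>j > 0\<close>. For
    \<open>j = 0\<close> the modulus is 1 and \<open>U\<close> is just \<open>{1}\<close>.\<close>
  have cop: "coprime (r x) (int d) \<longleftrightarrow> coprime x (int d)" if "j > 0" for x
  proof -
    have "int d dvd int m" using that by (simp add: m_def)
    then have "[x = r x] (mod int d)" using r(2) cong_dvd_modulus by blast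
    then show ?thesis using cong_imp_coprime cong_sym by blast
  qed
  have maps: "h e \<in> U" if "e \<in> U" for e
  proof (cases "j = 0")
    case True
    then show ?thesis using that r(1)[of "e * (k * e - s)"] by (auto simp: U_def h_def m_def)
  next
    case False
    then show ?thesis using that r(1) cop unit by (auto simp: U_def h_def)
  qed
  have inj: "inj_on h U"
  proof (rule inj_onI)
    fix x y assume xy: "x \<in> U" "y \<in> U" "h x = h y"
    have "[x * (k * x - s) = y * (k * y - s)] (mod int m)"
      using r(2) xy(3) unfolding h_def by (metis cong_sym cong_trans)
    then have "int m dvd (x - y) * (k * (x + y) - s)"
      by (simp add: cong_iff_dvd_diff algebra_simps)
    moreover have "coprime (int m) (k * (x + y) - s)"
      using unit[of "x + y"] by (simp add: m_def coprime_commute)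
    ultimately have "[x = y] (mod int m)"
      by (simp add: cong_iff_dvd_diff coprime_dvd_mult_left_iff)
    then show "x = y" using xy cong_imp_eq_atLeastAtMost by (auto simp: U_def)
  qed
  have "finite U" unfolding U_def by (rule finite_Collect_conjI) simp
  then have surj: "h ` U = U" using maps inj by (intro endo_inj_surj) auto
  define E where "E = {e \<in> {1..int m}. coprime e (int d) \<and> e * (k * e - s) \<in> S}"
  have mem: "h e \<in> S \<longleftrightarrow> e * (k * e - s) \<in> S" for e
    unfolding h_def using r(2) periodicD[OF per] m_def by blast
  then have E: "E = {e \<in> U. h e \<in> S}" by (auto simp: E_def U_def)
  have "h ` E = S \<inter> U" using surj E by auto
  also have "S \<inter> U = S \<inter> {1..int m}" using S by (auto simp: U_def)
  finally have "card (S \<inter> {1..int m}) = card (h ` E)" by simp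
  also have "\<dots> = card E" using inj by (intro card_image) (auto simp: E inj_on_def)
  finally show ?thesis by (simp add: E_def m_def)
qed

section \<open>One step of the iteration\<close>

lemma chi_ord_eq_enat_iff:
  "chi_ord x = enat n \<longleftrightarrow> (chi ^^ n) x \<in> \<int> \<and> (\<forall>k<n. (chi ^^ k) x \<notin> \<int>)"
proof
  assume "chi_ord x = enat n"
  then have ex: "\<exists>k. (chi ^^ k) x \<in> \<int>" and n: "n = (LEAST k. (chi ^^ k) x \<in> \<int>)"
    by (auto simp: chi_ord_def split: if_splits)
  show "(chi ^^ n) x \<in> \<int> \<and> (\<forall>k<n. (chi ^^ k) x \<notin> \<int>)"
    unfolding n using LeastI_ex[OF ex] not_less_Least by blast
next
  assume n: "(chi ^^ n) x \<in> \<int> \<and> (\<forall>k<n. (chi ^^ k) x \<notin> \<int>)"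
  then have "(LEAST k. (chi ^^ k) x \<in> \<int>) = n"
    by (intro Least_equality) (auto simp: not_less[symmetric])
  then show "chi_ord x = enat n" using n by (auto simp: chi_ord_def)
qed

lemma chi_ord_Suc_iff:
  assumes "x \<notin> \<int>"
  shows "chi_ord x = enat (Suc n) \<longleftrightarrow> chi_ord (chi x) = enat n"
  using assms unfolding chi_ord_eq_enat_iff
  by (auto simp: All_less_Suc2 funpow_Suc_right simp del: funpow.simps)

lemma chi_ord_zero_iff: "chi_ord x = enat 0 \<longleftrightarrow> x \<in> \<int>"
  by (simp add: chi_ord_eq_enat_iff)

lemma coprime_fraction_not_Ints:
  assumes "coprime a (int M)" "M > 1"
  shows "(of_int a / of_nat M :: rat) \<notin> \<int>"
proof
  assume "(of_int a / of_nat M :: rat) \<in> \<int>"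
  then obtain z where "of_int a / of_nat M = (of_int z :: rat)" by (auto elim: Ints_cases)
  then have "of_int a = (of_int (z * int M) :: rat)" using assms(2) by (simp add: field_simps)
  then have "a = z * int M" by (simp only: of_int_eq_iff)
  then show False using assms by auto
qed

lemma ord_set_zero: "M > 1 \<Longrightarrow> ord_set 0 M = {}"
  using coprime_fraction_not_Ints by (auto simp: ord_set_def chi_ord_zero_iff)

lemma ord_set_one: "ord_set n 1 = (if n = 0 then UNIV else {})"
proof -
  have "chi_ord (of_int a) = enat 0" for a by (simp add: chi_ord_zero_iff)
  then show ?thesis by (auto simp: ord_set_def)
qed

text \<open>The bounds on \<open>s\<close> make \<open>g * e\<close> the ceiling of
  \<open>a / M\<close>, so \<open>chi\<close> sends \<open>a / M\<close> to
  \<open>e * a / d\<close>. This fraction is again reduced, as both \<open>e\<close> and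
  \<open>a\<close> are coprime to \<open>d\<close>, and for \<open>M > 1\<close> one application of
  \<open>chi\<close> lowers the order by one.\<close>

lemma ord_set_Suc_iff:
  fixes e s :: int
  assumes M: "M = g * d" "M > 1" and s: "0 \<le> s" "s < int M" and e: "coprime e (int d)"
  shows "int g * e * int M - s \<in> ord_set (Suc n) M \<longleftrightarrow>
    coprime s (int M) \<and> e * (int g * e * int M - s) \<in> ord_set n d"
proof -
  define a where "a = int g * e * int M - s"
  have gcd_eq: "gcd a (int M) = gcd s (int M)"
  proof -
    have "[a = - s] (mod int M)" by (simp add: a_def cong_iff_dvd_diff)
    then have "gcd a (int M) = gcd (- s) (int M)" by (rule cong_gcd_eq)
    then show ?thesis by simp
  qed
  show ?thesis
  proof (cases "coprime s (int M)")
    case False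
    then show ?thesis using gcd_eq by (auto simp: ord_set_def a_def coprime_iff_gcd_eq_1)
  next
    case True
    then have copa: "coprime a (int M)" using gcd_eq by (simp add: coprime_iff_gcd_eq_1)
    have copd: "coprime (e * a) (int d)" using copa e M by simp
    have pos: "g > 0" "d > 0" using M by (auto intro: Nat.gr0I)
    define x :: rat where "x = of_int a / of_nat M"
    have x: "x = of_int (int g * e) - of_int s / of_nat M"
      using M(2) by (simp add: x_def a_def field_simps)
    have "0 \<le> (of_int s / of_nat M :: rat)" using s by simp
    moreover have "(of_int s / of_nat M :: rat) < 1"
    proof -
      have "(of_int s :: rat) < of_int (int M)" using s by (simp only: of_int_less_iff)
      then show ?thesis using M(2) by (simp add: field_simps)
    qed
    ultimately have "\<lceil>x\<rceil> = int g * e"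
      unfolding x by (intro ceiling_unique) auto
    then have "chi x = of_int (e * a) / of_nat d"
      using pos unfolding chi_def x_def by (simp add: M(1) field_simps)
    then have "chi_ord x = enat (Suc n) \<longleftrightarrow> chi_ord (of_int (e * a) / of_nat d) = enat n"
      using chi_ord_Suc_iff[of x] coprime_fraction_not_Ints[OF copa M(2)] by (simp add: x_def)
    then show ?thesis
      using True copa copd unfolding ord_set_def x_def a_def by simp
  qed
qed

lemma ceiling_gcd_decomposition:
  fixes a :: int
  assumes "M > 0"
  obtains g d e s where "M = g * d" "0 \<le> s" "s < int M" "coprime e (int d)"
    "a = int g * e * int M - s"
proof -
  \<comment> \<open>\<open>div\<close> rounds down, so the two negations produce the ceiling of
    \<open>a / M\<close>; \<open>s\<close> is the matching remainder of \<open>- a\<close>.\<close>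
  define c where "c = - ((- a) div int M)"
  define s where "s = (- a) mod int M"
  define g where "g = nat (gcd c (int M))"
  have g: "int g = gcd c (int M)" by (simp add: g_def)
  have "g dvd M" by (metis g gcd_dvd2 of_nat_dvd_iff)
  then obtain d where d: "M = g * d" by auto
  have "int g dvd c" by (simp add: g)
  then obtain e where e: "c = int g * e" by auto
  have "int g > 0" using assms d by (auto intro: Nat.gr0I)
  moreover have "gcd (int g * e) (int g * int d) = int g" using g d e by simp
  ultimately have "coprime e (int d)"
    by (simp add: gcd_mult_distrib_int[symmetric] coprime_iff_gcd_eq_1)
  moreover have "a = int g * e * int M - s"
    using div_mult_mod_eq[of "- a" "int M"] unfolding e[symmetric] c_def s_def by linarith
  moreover have "0 \<le> s" "s < int M" using assms by (auto simp: s_def)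
  ultimately show ?thesis using d that by blast
qed

text \<open>Induction on \<open>n\<close>: moving \<open>a\<close> by a multiple of
  \<open>M ^ (n + 2)\<close> keeps \<open>s\<close>, \<open>g\<close> and \<open>d\<close> and moves
  \<open>e\<close> by a multiple of \<open>d * M ^ n\<close>. Both \<open>e\<close> and
  \<open>a\<close> are then unchanged modulo \<open>d ^ (n + 1)\<close>, hence so is the next
  numerator \<open>e * a\<close>.\<close>

lemma periodic_ord_set:
  assumes "M > 0"
  shows "periodic (M ^ (n + 1)) (ord_set n M)"
  using assms
proof (induction n arbitrary: M)
  case 0
  then show ?case
    using ord_set_zero[of M] ord_set_one[of 0] by (cases "M = 1") (auto simp: periodic_def)
next
  case (Suc n)
  show ?case
  proof (cases "M = 1")
    case True
    then show ?thesis using ord_set_one[of "Suc n"] by (auto simp: periodic_def)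
  next
    case False
    then have M1: "M > 1" using Suc.prems by simp
    show ?thesis unfolding periodic_def
    proof (intro allI impI)
      fix a b :: int
      assume cong: "[a = b] (mod int (M ^ (Suc n + 1)))" and a: "a \<in> ord_set (Suc n) M"
      obtain g d e s where D: "M = g * d" "0 \<le> s" "s < int M" "coprime e (int d)"
        "a = int g * e * int M - s"
        by (rule ceiling_gcd_decomposition[OF Suc.prems])
      have "int (M ^ (Suc n + 1)) dvd b - a"
        using cong_sym[OF cong] by (simp only: cong_iff_dvd_diff)
      then obtain t where t: "b - a = int (M ^ (Suc n + 1)) * t" by (elim dvdE)
      \<comment> \<open>Since \<open>M ^ (n + 2) = g * (d * M ^ n) * M\<close>, the whole shift of
        \<open>a\<close> is absorbed into \<open>e\<close>.\<close>
      define u where "u = e + int d * int M ^ n * t"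
      have "a + int (M ^ (Suc n + 1)) * t = int g * u * int M - s"
      proof -
        have "int (M ^ (Suc n + 1)) = int g * (int d * int M ^ n) * int M"
          using D(1) by (simp add: mult_ac)
        then show ?thesis unfolding u_def D(5) by (simp add: algebra_simps)
      qed
      then have b: "b = int g * u * int M - s" using t by simp
      have "[u = e] (mod int d)" by (simp add: u_def cong_iff_dvd_diff)
      then have u: "coprime u (int d)" using D(4) cong_imp_coprime cong_sym by blast
      have "d ^ n dvd M ^ n" by (simp add: D(1) dvd_power_same)
      then have "int d * int d ^ n dvd int d * int M ^ n"
        by (metis dvd_refl mult_dvd_mono of_nat_dvd_iff of_nat_power)
      then have "[e = u] (mod int (d ^ (n + 1)))"
        by (simp add: u_def cong_iff_dvd_diff)
      moreover have "[a = b] (mod int (d ^ (n + 1)))"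
      proof -
        have "d ^ (n + 1) dvd M ^ (n + 1)" by (rule dvd_power_same) (simp add: D(1))
        also have "M ^ (n + 1) dvd M ^ (Suc n + 1)" by (intro le_imp_power_dvd) simp
        finally show ?thesis using cong cong_dvd_modulus of_nat_dvd_iff by blast
      qed
      ultimately have "[e * a = u * b] (mod int (d ^ (n + 1)))" by (rule cong_mult)
      moreover have "e * a \<in> ord_set n d" using a ord_set_Suc_iff[OF D(1) M1 D(2,3,4)] D(5) by simp
      moreover have "d > 0" using Suc.prems D(1) by (cases d) auto
      ultimately have "u * b \<in> ord_set n d" using periodicD[OF Suc.IH[of d]] by blast
      moreover have "coprime s (int M)" using a ord_set_Suc_iff[OF D(1) M1 D(2,3,4)] D(5) by simp
      ultimately show "b \<in> ord_set (Suc n) M"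
        using ord_set_Suc_iff[OF D(1) M1 D(2,3) u] b by simp
    qed
  qed
qed

lemma class_count_eq_card:
  assumes "M > 0"
  shows "class_count n M = card (ord_set n M \<inter> {1..int (M ^ (n + 1))})"
  unfolding class_count_def
  using card_cong_classes_subset[OF periodic_ord_set[OF assms]] assms by simp

section \<open>The recurrence\<close>

text \<open>\<open>totatives\<close> lives in \<open>{1..M}\<close> while remainders live in
  \<open>{0..<M}\<close>; for \<open>M > 1\<close> neither 0 nor \<open>M\<close> is coprime to
  \<open>M\<close>, so the two ranges give the same count.\<close>

lemma card_coprime_residues:
  assumes "M > 1"
  shows "card {s \<in> {0..<int M}. coprime s (int M)} = totient M"
proof -
  have "{s \<in> {0..<int M}. coprime s (int M)} = int ` totatives M"
  proof (intro equalityI subsetI)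
    fix s assume s: "s \<in> {s \<in> {0..<int M}. coprime s (int M)}"
    then have "s \<noteq> 0" using assms by auto
    then obtain k where k: "s = int k" "k > 0" using s by (auto elim!: nonneg_int_cases)
    then show "s \<in> int ` totatives M" using s by (auto simp: totatives_def)
  next
    fix s assume "s \<in> int ` totatives M"
    then obtain k where k: "s = int k" "0 < k" "k \<le> M" "coprime k M" by (auto simp: totatives_def)
    moreover have "k \<noteq> M" using k assms by auto
    ultimately show "s \<in> {s \<in> {0..<int M}. coprime s (int M)}" by auto
  qed
  then show ?thesis by (simp add: totient_def card_image)
qed

text \<open>The condition on \<open>e\<close> has period \<open>d ^ (n + 1)\<close>, and the range
  consists of \<open>g ^ n\<close> such periods. Each contributes \<open>class_count n d\<close>, by
  the permutation of units with \<open>k = g * M\<close>, a multiple of \<open>d\<close>.\<close>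

lemma card_step_fibre:
  fixes s :: int
  assumes M: "M = g * d" "M > 1" and s: "coprime s (int M)"
  shows "card {e \<in> {1..int (d * M ^ n)}. coprime e (int d) \<and> e * (int g * e * int M - s) \<in> ord_set n d}
    = g ^ n * class_count n d"
proof -
  have d: "d > 0" using M by (auto intro: Nat.gr0I)
  define E where "E = {e. coprime e (int d) \<and> e * (int g * e * int M - s) \<in> ord_set n d}"
  have per: "periodic (d ^ (n + 1)) E"
    unfolding periodic_def
  proof (intro allI impI)
    fix a b assume ab: "[a = b] (mod int (d ^ (n + 1)))" and a: "a \<in> E"
    have "[a * (int g * a * int M - s) = b * (int g * b * int M - s)] (mod int (d ^ (n + 1)))"
      by (intro cong_mult cong_diff cong_refl ab)
    moreover have "[a = b] (mod int d)"
      using ab by (rule cong_dvd_modulus) simp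
    then have "coprime b (int d)" using a cong_imp_coprime by (auto simp: E_def)
    ultimately show "b \<in> E" using a periodicD[OF periodic_ord_set[OF d]] by (auto simp: E_def)
  qed
  have "d * M ^ n = d ^ (n + 1) * g ^ n" by (simp add: M(1) power_mult_distrib)
  then have "card (E \<inter> {1..int (d * M ^ n)}) = g ^ n * card (E \<inter> {1..int (d ^ (n + 1))})"
    using card_periodic_mult[OF per] by metis
  also have "E \<inter> {1..int (d ^ (n + 1))} = {e \<in> {1..int (d ^ (n + 1))}. coprime e (int d) \<and>
      e * ((int g * int M) * e - s) \<in> ord_set n d}"
    by (auto simp: E_def mult_ac)
  also have "card \<dots> = card (ord_set n d \<inter> {1..int (d ^ (n + 1))})"
  proof (rule card_quadratic_preimage[OF periodic_ord_set[OF d] d])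
    show "int d dvd int g * int M" "coprime s (int d)" using s by (auto simp: M(1))
  qed (simp add: ord_set_def)
  also have "\<dots> = class_count n d" using class_count_eq_card[OF d] by simp
  also have "E \<inter> {1..int (d * M ^ n)} = {e \<in> {1..int (d * M ^ n)}. coprime e (int d) \<and>
      e * (int g * e * int M - s) \<in> ord_set n d}"
    by (auto simp: E_def)
  finally show ?thesis .
qed

text \<open>The integers counted on the left correspond bijectively to triples
  \<open>(s, d, e)\<close> through \<open>a = (M div d) * e * M - s\<close>. There are
  \<open>totient M\<close> choices of \<open>s\<close>, and the number of \<open>e\<close> for given
  \<open>s\<close> and \<open>d\<close> does not depend on \<open>s\<close>.\<close>

lemma class_count_Suc:
  assumes M1: "M > 1"
  shows "class_count (Suc n) M = totient M * (\<Sum>d | d dvd M. (M div d) ^ n * class_count n d)"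
proof -
  define R where "R = {s \<in> {0..<int M}. coprime s (int M)}"
  define D where "D = {d. d dvd M}"
  define E where "E s d = {e \<in> {1..int (d * M ^ n)}. coprime e (int d) \<and>
    e * (int (M div d) * e * int M - s) \<in> ord_set n d}" for s d
  define F where "F = (\<lambda>(s, d, e). int (M div d) * e * int M - s)"
  have fin: "finite R" "finite D" "\<And>s d. finite (E s d)"
  proof -
    show "finite R" unfolding R_def by (rule finite_Collect_conjI) simp
    show "finite D" using M1 by (simp add: D_def)
    show "finite (E s d)" for s d unfolding E_def by (rule finite_Collect_conjI) simp
  qed
  have Mdiv: "M = (M div d) * d" "M div d > 0" "d > 0" if "d \<in> D" for d
  proof -
    show "M = (M div d) * d" using that by (simp add: D_def)
    then show "M div d > 0" "d > 0" using M1 by (metis gr0I mult_is_0 not_less_zero)+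
  qed
  \<comment> \<open>The triple is recovered from \<open>a\<close> in stages: \<open>s\<close> as the
    residue of \<open>- a\<close> modulo \<open>M\<close>, then the ceiling \<open>c\<close>, then
    \<open>M div d\<close> as the gcd of \<open>c\<close> and \<open>M\<close>, and finally
    \<open>e\<close>.\<close>
  have "inj_on F (SIGMA s:R. SIGMA d:D. E s d)"
  proof (rule inj_onI)
    fix x y
    assume xy: "x \<in> (SIGMA s:R. SIGMA d:D. E s d)" "y \<in> (SIGMA s:R. SIGMA d:D. E s d)" "F x = F y"
    obtain s d e where x: "x = (s, d, e)" by (rule prod_cases3)
    obtain s' d' e' where y: "y = (s', d', e')" by (rule prod_cases3)
    have A: "s \<in> R" "d \<in> D" "e \<in> E s d" "s' \<in> R" "d' \<in> D" "e' \<in> E s' d'"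
      and eq: "F (s, d, e) = F (s', d', e')"
      using xy by (simp_all add: x y)
    define c where "c = int (M div d) * e"
    define c' where "c' = int (M div d') * e'"
    have eq': "c * int M - s = c' * int M - s'" using eq by (simp add: F_def c_def c'_def)
    then have "s - s' = (c - c') * int M" by (simp add: algebra_simps)
    then have "[s = s'] (mod int M)" by (simp add: cong_iff_dvd_diff)
    then have ss: "s = s'" using A by (intro cong_less_imp_eq_int[of _ "int M"]) (auto simp: R_def)
    then have cc: "c = c'" using eq' M1 by simp
    have g: "gcd (int (M div d) * e) (int M) = int (M div d)" if "d \<in> D" "coprime e (int d)" for d e
    proof -
      have "gcd (int (M div d) * e) (int (M div d) * int d) = int (M div d)"
        using that(2) by (simp add: gcd_mult_distrib_int[symmetric] coprime_iff_gcd_eq_1)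
      moreover have "int (M div d) * int d = int M"
        using arg_cong[OF Mdiv(1)[OF that(1)], of int] unfolding of_nat_mult by (rule sym)
      ultimately show ?thesis by (simp only:)
    qed
    have "int (M div d) = int (M div d')"
      using g[of d e] g[of d' e'] A cc by (simp add: E_def c_def c'_def)
    then have gg: "M div d = M div d'" by simp
    then have dd: "d = d'" using Mdiv[OF A(2)] Mdiv(1)[OF A(5)] by (metis mult_left_cancel not_gr_zero)
    have "e = e'" using cc dd Mdiv(2)[OF A(2)] by (simp add: c_def c'_def)
    then show "x = y" using ss dd x y by simp
  qed
  then have "card (F ` (SIGMA s:R. SIGMA d:D. E s d)) = card (SIGMA s:R. SIGMA d:D. E s d)"
    by (rule card_image)
  also have "\<dots> = (\<Sum>s\<in>R. \<Sum>d\<in>D. card (E s d))"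
    using fin by (simp add: card_SigmaI)
  also have "\<dots> = (\<Sum>s\<in>R. \<Sum>d\<in>D. (M div d) ^ n * class_count n d)"
    using card_step_fibre[OF Mdiv(1) M1] by (intro sum.cong refl) (auto simp: E_def R_def)
  also have "\<dots> = totient M * (\<Sum>d\<in>D. (M div d) ^ n * class_count n d)"
    using card_coprime_residues[OF M1] by (simp add: R_def)
  also have "F ` (SIGMA s:R. SIGMA d:D. E s d) = ord_set (Suc n) M \<inter> {1..int (M ^ (Suc n + 1))}"
  proof (intro equalityI subsetI)
    fix a assume "a \<in> F ` (SIGMA s:R. SIGMA d:D. E s d)"
    then obtain s d e where A: "s \<in> R" "d \<in> D" "e \<in> E s d" and a: "a = F (s, d, e)" by auto
    define g where "g = M div d"
    have g: "M = g * d" "g > 0" using Mdiv(1,2)[OF A(2)] unfolding g_def by this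
    have a': "a = int g * e * int M - s" by (simp add: a F_def g_def)
    have s: "0 \<le> s" "s < int M" "coprime s (int M)" using A(1) by (auto simp: R_def)
    have e: "1 \<le> e" "e \<le> int (d * M ^ n)" "coprime e (int d)" "e * a \<in> ord_set n d"
      using A(3) a' by (auto simp: E_def g_def)
    have mem: "a \<in> ord_set (Suc n) M"
      using ord_set_Suc_iff[OF g(1) M1 s(1,2) e(3)] s e a' by simp
    \<comment> \<open>The range of \<open>e\<close> is the right one: \<open>g * e \<ge> 1\<close>
      and \<open>s < M\<close> force \<open>a \<ge> 1\<close>, while the largest \<open>e\<close>
      gives \<open>g * (d * M ^ n) * M = M ^ (n + 2)\<close>.\<close>
    have "1 * 1 \<le> int g * e" using g(2) e(1) by (intro mult_mono) auto
    then have "1 * int M \<le> int g * e * int M" by (intro mult_right_mono) auto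
    then have "1 \<le> a" using s a' by linarith
    moreover have "int g * e * int M \<le> int g * int (d * M ^ n) * int M"
      using e(2) by (intro mult_right_mono mult_left_mono) auto
    then have "a \<le> int g * int (d * M ^ n) * int M" using s a' by linarith
    moreover have "int g * int (d * M ^ n) * int M = int (M ^ (Suc n + 1))"
      by (simp add: g(1) mult_ac)
    ultimately show "a \<in> ord_set (Suc n) M \<inter> {1..int (M ^ (Suc n + 1))}"
      using mem by (simp only: Int_iff atLeastAtMost_iff)
  next
    fix a assume a: "a \<in> ord_set (Suc n) M \<inter> {1..int (M ^ (Suc n + 1))}"
    obtain g d e s where G: "M = g * d" "0 \<le> s" "s < int M" "coprime e (int d)"
      "a = int g * e * int M - s"
      by (rule ceiling_gcd_decomposition[of M a]) (use M1 in simp)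
    have pos: "g > 0" "d > 0" using G(1) M1 by (auto intro: Nat.gr0I)
    then have Md: "M div d = g" using G(1) by simp
    have mem: "coprime s (int M)" "e * a \<in> ord_set n d"
      using a ord_set_Suc_iff[OF G(1) M1 G(2,3,4)] G(5) by auto
    have a': "a = int g * int M * e - s" by (simp add: G(5) mult_ac)
    then have "0 < int g * int M * e" using a G(2) by auto
    moreover have "0 \<le> int g * int M" by simp
    ultimately have "1 \<le> e" by (simp add: zero_less_mult_iff)
    \<comment> \<open>One step beyond the bound would give
      \<open>a \<ge> M ^ (n + 2) + g * M - s\<close>, which is too large because
      \<open>s < M \<le> g * M\<close>.\<close>
    moreover have "e \<le> int (d * M ^ n)"
    proof (rule ccontr)
      assume "\<not> e \<le> int (d * M ^ n)"
      then have "int (d * M ^ n) + 1 \<le> e" by simp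
      then have "int g * int M * (int (d * M ^ n) + 1) \<le> int g * int M * e"
        by (intro mult_left_mono) auto
      moreover have "int g * int M * (int (d * M ^ n) + 1) = int (M ^ (Suc n + 1)) + int g * int M"
        by (simp add: G(1) algebra_simps)
      moreover have "1 * int M \<le> int g * int M" using pos by (intro mult_right_mono) auto
      ultimately have "a > int (M ^ (Suc n + 1))" using G(3) a' by linarith
      then show False using a by simp
    qed
    ultimately have "e \<in> E s d" using mem G(4,5) by (simp add: E_def Md)
    moreover have "s \<in> R" "d \<in> D" using mem G by (auto simp: R_def D_def)
    moreover have "a = F (s, d, e)" by (simp add: F_def Md G(5))
    ultimately show "a \<in> F ` (SIGMA s:R. SIGMA d:D. E s d)" by blast
  qed
  finally show ?thesis using class_count_eq_card[of M "Suc n"] M1 by (simp add: D_def)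
qed

section \<open>Transition probabilities and summation of the densities\<close>

lemma class_density_Suc:
  assumes "M > 1"
  shows "real (class_count (Suc n) M) / real (totient (M ^ (Suc n + 1))) =
    (\<Sum>d | d dvd M. real (totient d) / real M *
      (real (class_count n d) / real (totient (d ^ (n + 1)))))"
proof -
  \<comment> \<open>This cancels \<open>totient M\<close> on the left. On the right each term
    reduces to \<open>class_count n d / (M * d ^ n)\<close>, as
    \<open>(M div d) ^ n / M ^ (n + 1) = 1 / (M * d ^ n)\<close>.\<close>
  have tot: "totient (k ^ (j + 1)) = k ^ j * totient k" for k j
    using totient_power[of "Suc j" k] by simp
  have "real (class_count (Suc n) M) / real (totient (M ^ (Suc n + 1))) =
      (\<Sum>d | d dvd M. real ((M div d) ^ n * class_count n d)) / real M ^ Suc n"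
    using assms by (simp only: class_count_Suc[OF assms] tot) simp
  also have "\<dots> = (\<Sum>d | d dvd M. real (totient d) / real M *
      (real (class_count n d) / real (totient (d ^ (n + 1)))))"
    unfolding sum_divide_distrib
  proof (intro sum.cong refl)
    fix d assume "d \<in> {d. d dvd M}"
    then obtain g where g: "M = d * g" by auto
    then have "d > 0" "g > 0" using assms by (auto intro: Nat.gr0I)
    then show "real ((M div d) ^ n * class_count n d) / real M ^ Suc n =
      real (totient d) / real M * (real (class_count n d) / real (totient (d ^ (n + 1))))"
      unfolding tot by (simp add: g power_mult_distrib field_simps)
  qed
  finally show ?thesis .
qed

text \<open>Monotonicity of the partial sums \<open>S n\<close> in
  \<open>S (n + 1) = q * S n + T n\<close> with \<open>T n \<le> 1 - q\<close> bounds them by 1. The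
  limit then exists and solves \<open>L = q * L + (1 - q)\<close>, so \<open>q < 1\<close> forces
  \<open>L = 1\<close>.\<close>

lemma sums_one_of_affine_recurrence:
  fixes p t :: "nat \<Rightarrow> real"
  assumes "\<And>n. p n \<ge> 0" "\<And>n. t n \<ge> 0" "p 0 = 0" "0 \<le> q" "q < 1"
    and t: "t sums (1 - q)" and rec: "\<And>n. p (Suc n) = q * p n + t n"
  shows "p sums 1"
proof -
  have sum_Suc: "(\<Sum>i<Suc n. p i) = q * (\<Sum>i<n. p i) + (\<Sum>i<n. t i)" for n
    unfolding sum.lessThan_Suc_shift by (simp add: assms(3) rec sum.distrib sum_distrib_left)
  have le: "(\<Sum>i<n. p i) \<le> 1" for n
  proof -
    have "(\<Sum>i<n. t i) \<le> 1 - q"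
      using t assms(2) sum_le_suminf[of t "{..<n}"] by (auto simp: sums_iff)
    moreover have "(\<Sum>i<n. p i) \<le> q * (\<Sum>i<n. p i) + (\<Sum>i<n. t i)"
      unfolding sum_Suc[symmetric] using assms(1) by simp
    ultimately have "(1 - q) * (\<Sum>i<n. p i) \<le> (1 - q) * 1" by (simp add: algebra_simps)
    then show ?thesis using assms(5) by simp
  qed
  then have "summable p" using assms(1) by (intro summableI_nonneg_bounded)
  then obtain L where L: "p sums L" by (auto simp: summable_def)
  \<comment> \<open>Dropping the first term does not change the sum because
    \<open>p 0 = 0\<close>.\<close>
  then have "(\<lambda>n. p (Suc n)) sums L" using sums_Suc_iff[of p L] assms(3) by simp
  moreover have "(\<lambda>n. p (Suc n)) sums (q * L + (1 - q))"
    unfolding rec by (intro sums_add sums_mult L t)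
  ultimately have "L = q * L + (1 - q)" by (rule sums_unique2)
  then have "(1 - q) * (L - 1) = 0" by (simp add: algebra_simps)
  then show ?thesis using L assms(5) by simp
qed

theorem theorem3p1:
  fixes M :: nat
  assumes "M \<ge> 1"
  shows "(\<lambda>n. real (class_count n M) / real (totient (M ^ (n + 1)))) sums 1"
  using assms
\<comment> \<open>Strong induction on the denominator: after leaving \<open>M\<close> the chain sits
  at a proper divisor, for which absorption is already known.\<close>
proof (induction M rule: less_induct)
  case (less M)
  define p where "p n k = real (class_count n k) / real (totient (k ^ (n + 1)))" for n k
  show ?case
  proof (cases "M = 1")
    case True
    have "class_count n 1 = (if n = 0 then 1 else 0)" for n
      using ord_set_one[of n] class_count_eq_card[of 1 n] by simp
    then have "(\<lambda>n. p n M) = (\<lambda>n. if n = 0 then 1 else 0)" using True by (auto simp: p_def)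
    then have "(\<lambda>n. p n M) sums 1" using sums_single[of 0 "\<lambda>_. 1 :: real"] by simp
    then show ?thesis by (simp add: p_def)
  next
    case False
    then have M1: "M > 1" using less.prems by simp
    define D where "D = {d. d dvd M \<and> d \<noteq> M}"
    have D: "{d. d dvd M} = insert M D" "finite D" "M \<notin> D"
      using M1 by (auto simp: D_def)
    \<comment> \<open>\<open>q\<close> is the probability of staying at \<open>M\<close>;
      \<open>t n\<close> collects the moves to proper divisors followed by order exactly
      \<open>n\<close>.\<close>
    define q where "q = real (totient M) / real M"
    define t where "t n = (\<Sum>d\<in>D. real (totient d) / real M * p n d)" for n
    \<comment> \<open>Gauss's divisor sum says that the transition probabilities from
      \<open>M\<close> add up to 1, so those to proper divisors add up to
      \<open>1 - q\<close>.\<close>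
    have "(\<Sum>d | d dvd M. real (totient d)) = real M"
      using totient_divisor_sum[of M] by (metis of_nat_sum)
    then have "real (totient M) + (\<Sum>d\<in>D. real (totient d)) = real M" using D by simp
    then have "(\<Sum>d\<in>D. real (totient d)) / real M = 1 - q"
      using M1 by (simp add: q_def field_simps)
    then have sumD: "(\<Sum>d\<in>D. real (totient d) / real M * 1) = 1 - q"
      by (simp add: sum_divide_distrib)
    have "(\<lambda>n. p n d) sums 1" if "d \<in> D" for d
    proof -
      have "d dvd M" "d \<noteq> M" using that by (auto simp: D_def)
      then have "d < M" "d \<ge> 1" using M1 dvd_imp_le[of d M] by (auto intro: Nat.gr0I simp: Suc_le_eq)
      then show ?thesis using less.IH by (simp add: p_def)
    qed
    then have t: "t sums (1 - q)"
      unfolding t_def sumD[symmetric] by (intro sums_sum sums_mult)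
    have "(\<lambda>n. p n M) sums 1"
    proof (rule sums_one_of_affine_recurrence[OF _ _ _ _ _ t])
      show "p n M \<ge> 0" "t n \<ge> 0" for n by (auto simp: p_def t_def intro!: sum_nonneg)
      show "p 0 M = 0" using class_count_eq_card[of M 0] ord_set_zero[OF M1] M1 by (simp add: p_def)
      show "0 \<le> q" by (simp add: q_def)
      show "q < 1" using totient_less[OF M1] M1 by (simp add: q_def)
      show "p (Suc n) M = q * p n M + t n" for n
        using class_density_Suc[OF M1, of n] D unfolding p_def q_def t_def by simp
    qed
    then show ?thesis by (simp add: p_def)
  qed
qed

end
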